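(* Let $S\in(0,\infty)$ and let $\phi\in L^\infty(0,S)$ be a nonnegative function. Suppose that there exist constants $\delta>b\ge0$, a nonnegative function $g\in L^1(0,S)$ and a locally bounded Borel measurable function $N:[0,\infty)\to\mathbb{R}$ satisfying $$N(r)\le0\quad\text{for } r\in[0,\delta]$$ such that $$\phi(t)\le b+[g*N(\phi(\cdot))](t)\quad\text{for a.e. } t\in(0,S).$$ Then $\|\phi\|_{L^\infty(0,S)}\le b$.
   Context: Convolution: $(g*w)(t)=\int_0^tg(t-s)w(s)\,\mathrm{d}s$. *)

theory Defs
  imports "HOL-Analysis.Analysis" "HOL-Probability.Essential_Supremum"
begin

text \<open>
  Elements of \<open>L\<^sup>1(0,S)\<close> and \<open>L\<^sup>\<infinity>(0,S)\<close> are represented by Lebesgue measurable functions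
  \<open>real \<Rightarrow> real\<close>, their values outside \<open>(0,S)\<close> being irrelevant, and pointwise properties of
  such elements (e.g. nonnegativity) are understood almost everywhere on \<open>(0,S)\<close>.
\<close>

text \<open>
  The norm takes values in \<^typ>\<open>ereal\<close> because \<^const>\<open>esssup\<close> needs a complete lattice; it is
  \<open>\<infinity>\<close> for unbounded (and for non-measurable) functions.
\<close>

definition Linf_norm :: "'a measure \<Rightarrow> ('a \<Rightarrow> real) \<Rightarrow> ereal"
  where "Linf_norm M f = esssup M (\<lambda>x. ereal \<bar>f x\<bar>)"

definition in_Linf :: "'a measure \<Rightarrow> ('a \<Rightarrow> real) \<Rightarrow> bool"
  where "in_Linf M f \<longleftrightarrow> f \<in> borel_measurable M \<and> Linf_norm M f < \<infinity>"

text \<open>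
  Convolution on the half-line. Only the values of \<open>g\<close> and \<open>w\<close> on \<open>(0,t)\<close> matter, up to null
  sets. As usual for the Bochner integral, the value is \<open>0\<close> where the integrand is not
  integrable; this cannot happen for \<open>g\<close> in \<open>L\<^sup>1(0,S)\<close>, \<open>w\<close> in \<open>L\<^sup>\<infinity>(0,S)\<close> and
  \<open>t \<in> (0,S)\<close>.
\<close>

definition convol :: "(real \<Rightarrow> real) \<Rightarrow> (real \<Rightarrow> real) \<Rightarrow> real \<Rightarrow> real"
  where "convol g w t = (LINT s:{0..t}|lebesgue. g (t - s) * w s)"

definition locally_bounded_on :: "'a::topological_space set \<Rightarrow> ('a \<Rightarrow> 'b::metric_space) \<Rightarrow> bool"
  where "locally_bounded_on A f \<longleftrightarrow>
    (\<forall>x\<in>A. \<exists>U. openin (top_of_set A) U \<and> x \<in> U \<and> bounded (f ` U))"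

end

theory Submission
  imports Defs
begin

text \<open>
  Let \<open>C \<ge> 0\<close> bound \<open>N\<close> on the essential range of \<open>\<phi>\<close> and choose \<open>h > 0\<close> with
  \<open>C \<integral>\<^sub>0\<^sup>h g \<le> \<delta> - b\<close>. If \<open>\<phi> \<le> \<delta>\<close> on \<open>(0,a)\<close>, then \<open>N(\<phi>) \<le> 0\<close> there, so for \<open>t < a + h\<close> only
  \<open>s \<in> (a,t)\<close> can contribute positively to \<open>[g * N(\<phi>)](t)\<close>; hence the convolution is at most
  \<open>\<delta> - b\<close> and \<open>\<phi> \<le> \<delta>\<close> on \<open>(0,a + h)\<close>. Finitely many steps give \<open>\<phi> \<le> \<delta>\<close> on \<open>(0,S)\<close>, so that
  \<open>N(\<phi>) \<le> 0\<close> and the hypothesis reads \<open>\<phi> \<le> b\<close>.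
\<close>

text \<open>Finitely many of the neighbourhoods on which \<open>f\<close> is bounded cover
  \<open>K\<close>.\<close>

lemma bounded_image_compact_if_locally_bounded_on:
  assumes "locally_bounded_on A f" "compact K" "K \<subseteq> A"
  shows "bounded (f ` K)"
proof -
  have "\<forall>x\<in>K. \<exists>T. open T \<and> x \<in> T \<and> bounded (f ` (A \<inter> T))"
  proof
    fix x assume "x \<in> K"
    then obtain U where "openin (top_of_set A) U" "x \<in> U" "bounded (f ` U)"
      using assms unfolding locally_bounded_on_def by blast
    then show "\<exists>T. open T \<and> x \<in> T \<and> bounded (f ` (A \<inter> T))"
      unfolding openin_open by blast
  qed
  then obtain T where T: "\<And>x. x \<in> K \<Longrightarrow> open (T x) \<and> x \<in> T x \<and> bounded (f ` (A \<inter> T x))"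
    by metis
  obtain D where D: "D \<subseteq> K" "finite D" "K \<subseteq> (\<Union>x\<in>D. T x)"
    using compactE_image[OF assms(2), of K T] T by blast
  have "bounded (\<Union>x\<in>D. f ` (A \<inter> T x))"
    using D T by (intro bounded_UN) auto
  moreover have "f ` K \<subseteq> (\<Union>x\<in>D. f ` (A \<inter> T x))"
    using D(3) assms(3) by blast
  ultimately show ?thesis by (rule bounded_subset)
qed

lemma lebesgue_distr_reflect: "distr lebesgue lebesgue (\<lambda>x. t - x) = (lebesgue :: real measure)"
  using lebesgue_real_affine[of "-1" t] by (simp add: density_1)

lemma measurable_lebesgue_reflect: "(\<lambda>x. t - x :: real) \<in> lebesgue \<rightarrow>\<^sub>M lebesgue"
  using lebesgue_affine_measurable[where c="\<lambda>x::real. -1" and t=t] by simp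

lemma AE_lebesgue_reflect:
  fixes t :: real
  assumes "AE x in lebesgue. P x"
  shows "AE x in lebesgue. P (t - x)"
proof -
  have "AE x in distr lebesgue lebesgue (\<lambda>x. t - x). P x"
    using assms unfolding lebesgue_distr_reflect .
  then show ?thesis by (rule AE_distrD[OF measurable_lebesgue_reflect])
qed

text \<open>Substitution \<open>r = t - s\<close> in the convolution. Working on the whole line,
  with indicators in place of limits of integration, leaves no limits to transform.\<close>

lemma has_bochner_integral_lebesgue_reflect:
  fixes f :: "real \<Rightarrow> 'a::{banach, second_countable_topology}"
  assumes "integrable lebesgue f"
  shows "has_bochner_integral lebesgue (\<lambda>x. f (t - x)) (integral\<^sup>L lebesgue f)"
proof -
  have f: "f \<in> borel_measurable lebesgue" using assms by simp
  show ?thesis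
    using assms integral_distr[OF measurable_lebesgue_reflect f, of t]
      integrable_distr_eq[OF measurable_lebesgue_reflect f, of t]
    by (simp add: lebesgue_distr_reflect has_bochner_integral_iff)
qed

text \<open>Dominated convergence: each fixed \<open>r > 0\<close> eventually lies outside the
  shrinking interval. This supplies the step length \<open>h\<close>.\<close>

lemma tendsto_integral_shrinking_interval:
  fixes g :: "real \<Rightarrow> real"
  assumes "0 < S" "integrable (lebesgue_on {0<..<S}) g"
  shows "(\<lambda>n. LINT r|lebesgue. indicator {0<..<S / real (Suc n)} r * \<bar>g r\<bar>) \<longlonglongrightarrow> 0"
proof -
  let ?G = "\<lambda>r. indicator {0<..<S} r * \<bar>g r\<bar>"
  let ?s = "\<lambda>n r. indicator {0<..<S / real (Suc n)} r * \<bar>g r\<bar>"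
  have G: "integrable lebesgue ?G"
    using integrable_abs[OF assms(2)] by (simp add: integrable_restrict_space)
  have le: "S / real (Suc n) \<le> S" for n
    using assms(1) by (simp add: field_simps)
  \<comment> \<open>\<open>g\<close> is known to be measurable only on \<open>(0,S)\<close>, so
    measurability of \<open>?s n\<close> is read off from the extension by zero
    \<open>?G\<close>.\<close>
  have s: "?s n = (\<lambda>r. indicator {0<..<S / real (Suc n)} r * ?G r)" for n
    using le[of n] by (auto simp: fun_eq_iff indicator_def)
  have "(\<lambda>n. integral\<^sup>L lebesgue (?s n)) \<longlonglongrightarrow> integral\<^sup>L lebesgue (\<lambda>r::real. 0::real)"
  proof (rule integral_dominated_convergence[where w="?G"])
    show "?s n \<in> borel_measurable lebesgue" for n
      unfolding s
      by (intro borel_measurable_times borel_measurable_indicator borel_measurable_integrable[OF G]) simp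
    have "(\<lambda>n. ?s n r) \<longlonglongrightarrow> 0" for r
    proof (cases "0 < r")
      case True
      have "(\<lambda>n. S / real (Suc n)) \<longlonglongrightarrow> 0"
        by (rule LIMSEQ_Suc[OF lim_const_over_n])
      then have "\<forall>\<^sub>F n in sequentially. S / real (Suc n) < r"
        using True by (rule order_tendstoD)
      then have "\<forall>\<^sub>F n in sequentially. ?s n r = 0"
        by (rule eventually_mono) auto
      then show ?thesis by (rule tendsto_eventually)
    qed simp
    then show "AE r in lebesgue. (\<lambda>n. ?s n r) \<longlonglongrightarrow> 0" by simp
    show "AE r in lebesgue. norm (?s n r) \<le> ?G r" for n
      using le[of n] by (auto simp: indicator_def)
  qed (use G in auto)
  then show ?thesis by simp
qed

text \<open>For almost every \<open>s < a\<close> in \<open>(0,t)\<close> the integrand is \<le> 0;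
  for \<open>s \<ge> a\<close> the argument \<open>t - s\<close> is below \<open>h\<close>, and
  there the integrand is at most \<open>C * g (t - s)\<close>. The absolute value makes the bound
  nonnegative everywhere, although \<open>g\<close> is so only almost everywhere on
  \<open>(0,S)\<close>.\<close>

lemma convol_le_if_nonpos_initially:
  fixes g w :: "real \<Rightarrow> real"
  assumes g: "integrable (lebesgue_on {0<..<S}) g" "AE r in lebesgue_on {0<..<S}. 0 \<le> g r"
    and w: "AE s in lebesgue_on {0<..<S}. w s \<le> C" "AE s in lebesgue_on {0<..<S}. s < a \<longrightarrow> w s \<le> 0"
    and "0 \<le> C" "h \<le> S" "t < S" "t < a + h"
  shows "convol g w t \<le> C * (LINT r|lebesgue. indicator {0<..<h} r * \<bar>g r\<bar>)"
proof -
  let ?G = "\<lambda>r. indicator {0<..<h} r * \<bar>g r\<bar>"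
  have "integrable lebesgue (\<lambda>r. indicator {0<..<S} r * \<bar>g r\<bar>)"
    using integrable_abs[OF g(1)] by (simp add: integrable_restrict_space)
  then have "integrable lebesgue (\<lambda>r. indicator {0<..<h} r *\<^sub>R (indicator {0<..<S} r * \<bar>g r\<bar>))"
    by (rule integrable_mult_indicator[rotated]) simp
  moreover have "(\<lambda>r. indicator {0<..<h} r *\<^sub>R (indicator {0<..<S} r * \<bar>g r\<bar>)) = ?G"
    using \<open>h \<le> S\<close> by (auto simp: fun_eq_iff indicator_def)
  ultimately have "integrable lebesgue ?G" by simp
  note G = has_bochner_integral_lebesgue_reflect[OF this, of t]
  have CG: "integrable lebesgue (\<lambda>s. C * ?G (t - s))"
    using G by (intro integrable_mult_right) (simp add: has_bochner_integral_iff)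
  have int_CG: "(LINT s|lebesgue. C * ?G (t - s)) = C * integral\<^sup>L lebesgue ?G"
    using G by (simp add: has_bochner_integral_iff)
  have "AE r in lebesgue. r \<in> {0<..<S} \<longrightarrow> 0 \<le> g r"
    using g(2) by (simp add: AE_restrict_space_iff)
  then have gt: "AE s in lebesgue. t - s \<in> {0<..<S} \<longrightarrow> 0 \<le> g (t - s)"
    by (rule AE_lebesgue_reflect)
  \<comment> \<open>The hypotheses say nothing at \<open>s = 0\<close> or at
    \<open>t - s = 0\<close>; these endpoints of \<open>{0..t}\<close> are discarded as null
    sets.\<close>
  have ne: "AE s in lebesgue. s \<noteq> c" for c :: real
    by (rule AE_completion) (rule AE_lborel_singleton)
  have w': "AE s in lebesgue. s \<in> {0<..<S} \<longrightarrow> w s \<le> C"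
    "AE s in lebesgue. s \<in> {0<..<S} \<longrightarrow> s < a \<longrightarrow> w s \<le> 0"
    using w by (simp_all add: AE_restrict_space_iff)
  have le: "AE s in lebesgue. indicator {0..t} s *\<^sub>R (g (t - s) * w s) \<le> C * ?G (t - s)"
    using gt w' ne[of 0] ne[of t]
  proof eventually_elim
    case (elim s)
    show ?case
    proof (cases "0 < s \<and> s < t")
      case True
      then have gs: "0 \<le> g (t - s)" and ws: "w s \<le> C" "s < a \<longrightarrow> w s \<le> 0"
        using elim \<open>t < S\<close> by auto
      show ?thesis
      proof (cases "s < a")
        case True
        have "g (t - s) * w s \<le> 0"
          using gs ws True by (simp add: mult_nonneg_nonpos)
        moreover have "0 \<le> C * ?G (t - s)" using \<open>0 \<le> C\<close> by simp
        ultimately show ?thesis by (auto simp: indicator_def)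
      next
        case False
        then have "t - s \<in> {0<..<h}" using True \<open>t < a + h\<close> by auto
        moreover have "g (t - s) * w s \<le> C * g (t - s)"
          using mult_left_mono[OF ws(1) gs] by (simp add: mult.commute)
        ultimately show ?thesis using True gs by simp
      qed
    next
      case False
      then show ?thesis using elim \<open>0 \<le> C\<close> by (auto simp: indicator_def)
    qed
  qed
  \<comment> \<open>If the integrand is not integrable, the integral has the default value 0, which
    is below the nonnegative right-hand side.\<close>
  have "convol g w t \<le> (LINT s|lebesgue. C * ?G (t - s))"
  proof (cases "integrable lebesgue (\<lambda>s. indicator {0..t} s *\<^sub>R (g (t - s) * w s))")
    case True
    then show ?thesis
      unfolding convol_def set_lebesgue_integral_def by (rule integral_mono_AE[OF _ CG le])
  next
    case False
    then have "convol g w t = 0"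
      unfolding convol_def set_lebesgue_integral_def by (rule not_integrable_integral_eq)
    then show ?thesis using \<open>0 \<le> C\<close> by (simp add: integral_nonneg_AE)
  qed
  then show ?thesis by (simp only: int_CG)
qed

theorem lemma6p1:
  fixes S b \<delta> :: real
    and \<phi> g N :: "real \<Rightarrow> real"
  assumes "0 < S"
    and "in_Linf (lebesgue_on {0<..<S}) \<phi>"
    and "AE t in lebesgue_on {0<..<S}. 0 \<le> \<phi> t"
    and "0 \<le> b" and "b < \<delta>"
    and "integrable (lebesgue_on {0<..<S}) g"
    and "AE t in lebesgue_on {0<..<S}. 0 \<le> g t"
    and "N \<in> borel_measurable (restrict_space borel {0..})"
    and "locally_bounded_on {0..} N"
    and "\<And>r. r \<in> {0..\<delta>} \<Longrightarrow> N r \<le> 0"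
    and "AE t in lebesgue_on {0<..<S}. \<phi> t \<le> b + convol g (\<lambda>s. N (\<phi> s)) t"
  shows "Linf_norm (lebesgue_on {0<..<S}) \<phi> \<le> ereal b"
proof -
  let ?L = "lebesgue_on {0<..<S}"
  have meas: "(\<lambda>x. ereal \<bar>\<phi> x\<bar>) \<in> borel_measurable ?L"
    using assms(2) unfolding in_Linf_def by (intro borel_measurable_ereal borel_measurable_abs) simp
  obtain M where M: "Linf_norm ?L \<phi> \<le> ereal M"
    using assms(2) unfolding in_Linf_def by (cases "Linf_norm ?L \<phi>") auto
  have \<phi>_le_M: "AE t in ?L. \<phi> t \<le> M"
    using esssup_AE[of "\<lambda>x. ereal \<bar>\<phi> x\<bar>" ?L]
  proof eventually_elim
    case (elim t)
    then have "ereal \<bar>\<phi> t\<bar> \<le> ereal M"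
      using M unfolding Linf_norm_def by (rule order_trans)
    then show ?case by simp
  qed
  \<comment> \<open>Almost all values of \<open>\<phi>\<close> lie in the compact interval
    \<open>{0..M}\<close>.\<close>
  have "bounded (N ` {0..M})"
    using assms(9) by (rule bounded_image_compact_if_locally_bounded_on) auto
  then obtain C where C: "0 < C" "\<And>r. r \<in> {0..M} \<Longrightarrow> \<bar>N r\<bar> \<le> C"
    unfolding bounded_pos by auto
  have N_le_C: "AE s in ?L. N (\<phi> s) \<le> C"
    using assms(3) \<phi>_le_M
  proof eventually_elim
    case (elim s)
    then show ?case using C(2)[of "\<phi> s"] by auto
  qed
  define I where "I h = (LINT r|lebesgue. indicator {0<..<h} r * \<bar>g r\<bar>)" for h :: real
  have "(\<lambda>n. I (S / real (Suc n))) \<longlonglongrightarrow> 0"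
    unfolding I_def by (rule tendsto_integral_shrinking_interval[OF assms(1,6)])
  then have "\<forall>\<^sub>F n in sequentially. I (S / real (Suc n)) < (\<delta> - b) / C"
    by (rule order_tendstoD) (use assms(5) C(1) in simp)
  then obtain n where n: "I (S / real (Suc n)) < (\<delta> - b) / C"
    using eventually_happens sequentially_bot by blast
  \<comment> \<open>With this \<open>h\<close>, exactly \<open>Suc n\<close> steps reach
    \<open>S\<close>.\<close>
  define h where "h = S / real (Suc n)"
  have h: "0 < h" "h \<le> S" using assms(1) by (simp_all add: h_def field_simps)
  have CI: "C * I h \<le> \<delta> - b"
    using n C(1) unfolding h_def[symmetric] by (simp add: field_simps)
  have less_S: "AE t in ?L. t < S"
    by (intro AE_I2) (simp add: space_restrict_space)
  have step: "AE t in ?L. t < real k * h \<longrightarrow> \<phi> t \<le> \<delta>" for k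
  proof (induction k)
    case 0
    have "\<not> t < real 0 * h" if "t \<in> space ?L" for t
      using that by (simp add: space_restrict_space)
    then show ?case by (intro AE_I2) blast
  next
    case (Suc k)
    have N_nonpos: "AE s in ?L. s < real k * h \<longrightarrow> N (\<phi> s) \<le> 0"
      using Suc.IH assms(3) by eventually_elim (use assms(10) in auto)
    \<comment> \<open>The convolution bound with \<open>a = k * h\<close>. Since
      \<open>C * I h \<le> \<delta> - b\<close>, the hypothesis on \<open>\<phi>\<close> then gives
      \<open>\<phi> t \<le> b + (\<delta> - b) = \<delta>\<close>.\<close>
    have conv_le: "convol g (\<lambda>s. N (\<phi> s)) t \<le> C * I h" if "t < S" "t < real (Suc k) * h" for t
      unfolding I_def
      by (rule convol_le_if_nonpos_initially[OF assms(6,7) N_le_C N_nonpos])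
        (use that h C(1) in \<open>auto simp: algebra_simps\<close>)
    from less_S assms(11) show ?case
      by eventually_elim (use conv_le CI in fastforce)
  qed
  have N_nonpos: "AE s in ?L. s < S \<longrightarrow> N (\<phi> s) \<le> 0"
    using step[of "Suc n"] assms(3)
  proof eventually_elim
    case (elim s)
    moreover have "real (Suc n) * h = S" by (simp add: h_def)
    ultimately show ?case using assms(10) by auto
  qed
  \<comment> \<open>The same bound with \<open>a = S\<close> and \<open>h = 0\<close>: the interval
    \<open>{0<..<0}\<close> is empty, so the right-hand side vanishes.\<close>
  have conv_nonpos: "convol g (\<lambda>s. N (\<phi> s)) t \<le> 0" if "t < S" for t
    using convol_le_if_nonpos_initially[OF assms(6,7) N_le_C N_nonpos, of 0 t] that C(1) assms(1)
    by simp
  \<comment> \<open>Nonnegativity of \<open>\<phi>\<close> turns the one-sided bound into one on the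
    absolute value.\<close>
  have "AE t in ?L. ereal \<bar>\<phi> t\<bar> \<le> ereal b"
    using less_S assms(3,11) by eventually_elim (use conv_nonpos in fastforce)
  then show ?thesis
    unfolding Linf_norm_def by (rule esssup_I[OF meas])
qed

end
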